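(* The function $f:\mathbb{R}^{2\times2}\to\mathbb{R}$ defined by $f(X)=|X|^2\left(|X|^2-2\det X\right)$, where $|X|=\sqrt{\operatorname{tr}(X^\top X)}$ is the Frobenius norm, is SOS polyconvex but not lifted SOS polyconvex.
   Context: Let $p:\mathbb{R}^{2\times2}\to\mathbb{R}^5$, $p(X)=(X_{11},X_{21},X_{12},X_{22},\det X)$. A polynomial is SOS if it is a finite sum of squares of real polynomials. A polynomial $g:\mathbb{R}^5\to\mathbb{R}$ is SOS convex if $\langle y,\nabla^2 g(x)y\rangle$ is an SOS polynomial in the variables $(x,y)\in\mathbb{R}^5\times\mathbb{R}^5$. A polynomial $f:\mathbb{R}^{2\times2}\to\mathbb{R}$ is lifted SOS polyconvex if there is an SOS-convex polynomial $g:\mathbb{R}^5\to\mathbb{R}$ with $f=g\circ p$. It is SOS polyconvex if there is a polynomial map $q:\mathbb{R}^{2\times2}\to\mathbb{R}^5$ such that $f(X)-f(Y)-\langle q(Y),p(X)-p(Y)\rangle$ is an SOS polynomial in the entries of $X$ and $Y$. *)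

theory Defs
  imports "HOL-Analysis.Analysis"
begin

text \<open>A real polynomial in the coordinates of a Euclidean space is represented by its polynomial
  function (\<^const>\<open>real_polynomial_function\<close>); over the reals the two notions
  determine each other. Polynomials in two groups of variables are polynomial functions on the
  product space.\<close>

definition sos :: "('a::euclidean_space \<Rightarrow> real) \<Rightarrow> bool" where
  "sos f \<longleftrightarrow> (\<exists>(n::nat) (h :: nat \<Rightarrow> 'a \<Rightarrow> real).
     (\<forall>i<n. real_polynomial_function (h i)) \<and> (\<forall>x. f x = (\<Sum>i<n. (h i x)\<^sup>2)))"

definition partial_deriv :: "'n::finite \<Rightarrow> (real ^ 'n \<Rightarrow> real) \<Rightarrow> real ^ 'n \<Rightarrow> real" where
  "partial_deriv i g x = frechet_derivative g (at x) (axis i 1)"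

definition hessian :: "(real ^ 'n::finite \<Rightarrow> real) \<Rightarrow> real ^ 'n \<Rightarrow> real ^ 'n ^ 'n" where
  "hessian g x = (\<chi> i j. partial_deriv i (partial_deriv j g) x)"

definition sos_convex :: "(real ^ 5 \<Rightarrow> real) \<Rightarrow> bool" where
  "sos_convex g \<longleftrightarrow> real_polynomial_function g \<and>
     sos (\<lambda>(x, y). y \<bullet> (hessian g x *v y))"

text \<open>Row index first: \<open>X $ i $ j\<close> is the entry in row \<open>i\<close> and column \<open>j\<close>, so
  the four entries are listed column by column.\<close>

definition minors :: "real ^ 2 ^ 2 \<Rightarrow> real ^ 5" where
  "minors X = vector [X $ 1 $ 1, X $ 2 $ 1, X $ 1 $ 2, X $ 2 $ 2, det X]"

definition lifted_sos_polyconvex :: "(real ^ 2 ^ 2 \<Rightarrow> real) \<Rightarrow> bool" where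
  "lifted_sos_polyconvex f \<longleftrightarrow> real_polynomial_function f \<and>
     (\<exists>g. sos_convex g \<and> f = g \<circ> minors)"

definition sos_polyconvex :: "(real ^ 2 ^ 2 \<Rightarrow> real) \<Rightarrow> bool" where
  "sos_polyconvex f \<longleftrightarrow> real_polynomial_function f \<and>
     (\<exists>q :: real ^ 2 ^ 2 \<Rightarrow> real ^ 5. polynomial_function q \<and>
        sos (\<lambda>(X, Y). f X - f Y - q Y \<bullet> (minors X - minors Y)))"

definition frobenius_norm :: "real ^ 'n ^ 'm \<Rightarrow> real" where
  "frobenius_norm X = sqrt (trace (transpose X ** X))"

end

theory Submission
  imports Defs
begin

text \<open>Write \<open>a\<close> and \<open>b\<close> for the conformal and the anticonformal part of \<open>Y\<close> (vectors in the plane),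
  and \<open>z\<close>, \<open>w\<close> for those of \<open>X\<close>. Up to scaling, \<open>f(X) = (|z|\<^sup>2 + |w|\<^sup>2) |w|\<^sup>2\<close> and
  \<open>det X = |z|\<^sup>2 - |w|\<^sup>2\<close>. Choosing the multiplier of the determinant to be \<open>- |a|\<^sup>2\<close> turns the Bregman-type
  difference into
  \<open>|w|\<^sup>2 |z - a|\<^sup>2 + (|w|\<^sup>2 - |b|\<^sup>2 + a \<bullet> (z - a))\<^sup>2 + (a \<times> z)\<^sup>2 + 2 |b|\<^sup>2 |w - b|\<^sup>2\<close>.

  No convex polynomial \<open>g\<close> lifts \<open>f\<close>. Since \<open>f\<close> vanishes on conformal matrices, convexity gives
  \<open>g \<le> 0\<close> on the determinant half-axis \<open>d \<ge> 0\<close>; the values of \<open>f\<close> on anticonformal matrices give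
  \<open>g(0, -t\<^sup>2) \<le> 8 t\<^sup>4\<close>, and together with \<open>g(0, 0) = 0\<close> this forces \<open>g \<ge> 0\<close> on that half-axis. Being a
  polynomial, \<open>g\<close> vanishes on the whole determinant axis, and by convexity it then does not depend on
  the determinant at all. So \<open>f\<close> itself would be convex, which it is not.\<close>

section \<open>Coordinates in dimension five\<close>

lemma exhaust_5:
  fixes i :: 5
  shows "i = 1 \<or> i = 2 \<or> i = 3 \<or> i = 4 \<or> i = 5"
proof (induct i)
  case (of_int z)
  then have "z = 0 \<or> z = 1 \<or> z = 2 \<or> z = 3 \<or> z = 4" by auto
  then show ?case by auto
qed

lemma forall_5: "(\<forall>i::5. P i) \<longleftrightarrow> P 1 \<and> P 2 \<and> P 3 \<and> P 4 \<and> P 5"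
  by (metis exhaust_5)

lemma UNIV_5: "UNIV = {1, 2, 3, 4, 5::5}"
  using exhaust_5 by auto

lemma sum_5: "sum f (UNIV::5 set) = f 1 + f 2 + f 3 + f 4 + f 5"
  unfolding UNIV_5 by (simp add: ac_simps)

lemma vector_5 [simp]:
  "(vector [a, b, c, d, e] :: 'a::zero ^ 5) $ 1 = a"
  "(vector [a, b, c, d, e] :: 'a ^ 5) $ 2 = b"
  "(vector [a, b, c, d, e] :: 'a ^ 5) $ 3 = c"
  "(vector [a, b, c, d, e] :: 'a ^ 5) $ 4 = d"
  "(vector [a, b, c, d, e] :: 'a ^ 5) $ 5 = e"
  unfolding vector_def by simp_all

lemma polynomial_function_vec:
  fixes q :: "'a::real_normed_vector \<Rightarrow> real ^ 'n"
  assumes "\<And>i. real_polynomial_function (\<lambda>x. q x $ i)"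
  shows "polynomial_function q"
  unfolding polynomial_function_iff_Basis_inner
  using assms by (auto simp: Basis_vec_def inner_axis)

section \<open>Closure properties of sums of squares\<close>

lemma sos_scaled_square:
  assumes "real_polynomial_function h" "0 \<le> c"
  shows "sos (\<lambda>x. c * (h x)\<^sup>2)"
  unfolding sos_def
proof (intro exI conjI allI impI)
  show "real_polynomial_function ((\<lambda>i x. sqrt c * h x) (i::nat))" for i
    using assms by (auto intro: real_polynomial_function.intros)
  show "c * (h x)\<^sup>2 = (\<Sum>i<1::nat. ((\<lambda>i x. sqrt c * h x) i x)\<^sup>2)" for x
    using assms by (simp add: power_mult_distrib)
qed

lemma sos_add:
  assumes "sos f" "sos g"
  shows "sos (\<lambda>x. f x + g x)"
proof -
  obtain m :: nat and h where h: "\<And>i. i < m \<Longrightarrow> real_polynomial_function (h i)"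
    "\<And>x. f x = (\<Sum>i<m. (h i x)\<^sup>2)"
    using assms(1) unfolding sos_def by blast
  obtain n :: nat and k where k: "\<And>i. i < n \<Longrightarrow> real_polynomial_function (k i)"
    "\<And>x. g x = (\<Sum>i<n. (k i x)\<^sup>2)"
    using assms(2) unfolding sos_def by blast
  define l where "l i = (if i < m then h i else k (i - m))" for i
  have "f x + g x = (\<Sum>i<m + n. (l i x)\<^sup>2)" for x
  proof -
    have "(\<Sum>i<m + n. (l i x)\<^sup>2) = (\<Sum>i<m. (l i x)\<^sup>2) + (\<Sum>i<n. (l (m + i) x)\<^sup>2)"
      by (induction n) auto
    then show ?thesis
      by (simp add: l_def h(2) k(2))
  qed
  moreover have "real_polynomial_function (l i)" if "i < m + n" for i
    using that h(1) k(1)[of "i - m"] by (auto simp: l_def)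
  ultimately show ?thesis
    unfolding sos_def by blast
qed

lemma sos_nonneg: "sos f \<Longrightarrow> 0 \<le> f x"
  unfolding sos_def by (auto simp: sum_nonneg)

section \<open>Derivatives of polynomials and convexity along lines\<close>

lemma frechet_derivative_eq_sum_partial_deriv:
  fixes g :: "real ^ 'n \<Rightarrow> real"
  assumes "g differentiable (at x)"
  shows "frechet_derivative g (at x) v = (\<Sum>i\<in>UNIV. v $ i * partial_deriv i g x)"
proof -
  interpret linear "frechet_derivative g (at x)"
    using assms by (rule linear_frechet_derivative)
  have "frechet_derivative g (at x) (\<Sum>i\<in>UNIV. v $ i *\<^sub>R axis i 1)
      = (\<Sum>i\<in>UNIV. v $ i * partial_deriv i g x)"
    by (simp add: sum scale partial_deriv_def)
  then show ?thesis
    by (simp add: basis_expansion flip: scalar_mult_eq_scaleR)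
qed

text \<open>Sum and product rules carry an explicit polynomial derivative through the induction.
  This allows \<open>partial_deriv j g\<close> to be differentiated once more, as the Hessian
  demands.\<close>

lemma real_polynomial_function_partial_deriv:
  fixes g :: "real ^ 'n \<Rightarrow> real"
  assumes "real_polynomial_function g"
  shows "real_polynomial_function (partial_deriv i g)"
proof -
  have "\<exists>g'. real_polynomial_function g' \<and> (\<forall>x. frechet_derivative g (at x) (axis i 1) = g' x)"
    using assms
  proof induction
    case (linear h)
    then have "frechet_derivative h (at x) = h" for x
      by (metis bounded_linear_imp_has_derivative frechet_derivative_at)
    then show ?case
      by (intro exI[of _ "\<lambda>x. h (axis i 1)"]) (auto intro: real_polynomial_function.intros)
  next
    case (const c)
    show ?case
      by (intro exI[of _ "\<lambda>x. 0"]) (auto intro: real_polynomial_function.intros)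
  next
    case (add f g)
    then obtain f' g' where "real_polynomial_function f'" "real_polynomial_function g'"
      "\<And>x. frechet_derivative f (at x) (axis i 1) = f' x"
      "\<And>x. frechet_derivative g (at x) (axis i 1) = g' x"
      by blast
    moreover have "frechet_derivative (\<lambda>x. f x + g x) (at x)
        = (\<lambda>v. frechet_derivative f (at x) v + frechet_derivative g (at x) v)" for x
      using add.hyps
      by (intro frechet_derivative_at[symmetric] has_derivative_add)
        (simp_all add: frechet_derivative_works[symmetric] differentiable_at_real_polynomial_function)
    ultimately show ?case
      by (intro exI[of _ "\<lambda>x. f' x + g' x"]) (auto intro: real_polynomial_function.intros)
  next
    case (mult f g)
    then obtain f' g' where "real_polynomial_function f'" "real_polynomial_function g'"
      "\<And>x. frechet_derivative f (at x) (axis i 1) = f' x"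
      "\<And>x. frechet_derivative g (at x) (axis i 1) = g' x"
      by blast
    moreover have "frechet_derivative (\<lambda>x. f x * g x) (at x)
        = (\<lambda>v. f x * frechet_derivative g (at x) v + frechet_derivative f (at x) v * g x)" for x
      using mult.hyps
      by (intro frechet_derivative_at[symmetric] has_derivative_mult)
        (simp_all add: frechet_derivative_works[symmetric] differentiable_at_real_polynomial_function)
    ultimately show ?case
      using mult.hyps
      by (intro exI[of _ "\<lambda>x. f x * g' x + f' x * g x"]) (auto intro: real_polynomial_function.intros)
  qed
  then obtain g' where "real_polynomial_function g'"
    "\<And>x. frechet_derivative g (at x) (axis i 1) = g' x"
    by blast
  moreover from this have "partial_deriv i g = g'"
    by (auto simp: partial_deriv_def)
  ultimately show ?thesis by simp
qed

lemma has_real_derivative_along_line: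
  fixes g :: "real ^ 'n \<Rightarrow> real"
  assumes "real_polynomial_function g"
  shows "((\<lambda>t. g (x + t *\<^sub>R v)) has_real_derivative
           (\<Sum>i\<in>UNIV. v $ i * partial_deriv i g (x + t *\<^sub>R v))) (at t)"
proof -
  let ?D = "frechet_derivative g (at (x + t *\<^sub>R v))"
  have g: "g differentiable (at (x + t *\<^sub>R v))"
    using assms by (rule differentiable_at_real_polynomial_function)
  interpret linear ?D
    using g by (rule linear_frechet_derivative)
  have "((\<lambda>t. x + t *\<^sub>R v) has_derivative (\<lambda>h. h *\<^sub>R v)) (at t)"
    by (auto intro!: derivative_eq_intros)
  moreover have "(g has_derivative ?D) (at (x + t *\<^sub>R v))"
    using g by (simp add: frechet_derivative_works)
  ultimately have "((\<lambda>t. g (x + t *\<^sub>R v)) has_derivative (\<lambda>h. ?D (h *\<^sub>R v))) (at t)"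
    by (rule has_derivative_compose)
  moreover have "?D (h *\<^sub>R v) = (\<Sum>i\<in>UNIV. v $ i * partial_deriv i g (x + t *\<^sub>R v)) * h" for h
    unfolding frechet_derivative_eq_sum_partial_deriv[OF g]
    by (simp add: sum_distrib_left mult_ac)
  ultimately show ?thesis
    by (simp add: has_field_derivative_def)
qed

text \<open>Restricted to the line from x to y, \<open>g\<close> has as second derivative the
  Hessian form in direction y - x, which is nonnegative because it is a sum of squares.\<close>

lemma sos_convex_imp_convex_on:
  assumes "sos_convex g"
  shows "convex_on UNIV g"
proof (rule convex_onI)
  fix t :: real and x y :: "real ^ 5"
  assume t: "0 < t" "t < 1"
  have g: "real_polynomial_function g"
    using assms by (simp add: sos_convex_def)
  define v where "v = y - x"
  define g' where "g' t = (\<Sum>j\<in>UNIV. v $ j * partial_deriv j g (x + t *\<^sub>R v))" for t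
  define g'' where "g'' t = (\<Sum>j\<in>UNIV. v $ j *
      (\<Sum>i\<in>UNIV. v $ i * partial_deriv i (partial_deriv j g) (x + t *\<^sub>R v)))" for t
  have "convex_on UNIV (\<lambda>t. g (x + t *\<^sub>R v))"
  proof (rule f''_ge0_imp_convex)
    show "DERIV (\<lambda>t. g (x + t *\<^sub>R v)) s :> g' s" for s
      unfolding g'_def using g by (rule has_real_derivative_along_line)
    show "DERIV g' s :> g'' s" for s
      unfolding g'_def g''_def
      by (intro DERIV_sum DERIV_cmult has_real_derivative_along_line
          real_polynomial_function_partial_deriv g)
    show "0 \<le> g'' s" for s
    proof -
      have "g'' s = v \<bullet> (hessian g (x + s *\<^sub>R v) *v v)"
        unfolding g''_def inner_vec_def matrix_vector_mult_def hessian_def sum_distrib_left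
        \<comment> \<open>The matrix product sums over the column index inside, \<open>g''\<close>
          over the row index inside; exchanging the sums matches them.\<close>
        by (subst sum.swap) (simp add: sum_distrib_left mult_ac)
      then show ?thesis
        using sos_nonneg[of "\<lambda>(x, y). y \<bullet> (hessian g x *v y)" "(x + s *\<^sub>R v, v)"] assms
        by (simp add: sos_convex_def)
    qed
  qed auto
  \<comment> \<open>The parameters 0 and 1 correspond to x and y.\<close>
  from convex_onD[OF this, of t 0 1] t
  show "g ((1 - t) *\<^sub>R x + t *\<^sub>R y) \<le> (1 - t) * g x + t * g y"
    by (simp add: v_def algebra_simps)
qed auto

section \<open>Rigidity of convex functions and of polynomials\<close>

text \<open>The point \<open>x + t *\<^sub>R e\<close> is the limit, as s tends to 0 from the right,
  of convex combinations of x and the far point \<open>(t / s) *\<^sub>R e\<close>. The latter has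
  value c and weight s, so its contribution vanishes and \<open>g\<close> cannot increase under the
  shift; shifting back gives equality.\<close>

lemma convex_on_constant_along_line:
  fixes g :: "'a::real_normed_vector \<Rightarrow> real"
  assumes cvx: "convex_on UNIV g" and cont: "continuous_on UNIV g"
    and line: "\<And>t. g (t *\<^sub>R e) = c"
  shows "g (x + t *\<^sub>R e) = g x"
proof -
  have le: "g (x + t *\<^sub>R e) \<le> g x" for x t
  proof (rule tendsto_le[OF trivial_limit_at_right_real])
    show "((\<lambda>s. (1 - s) * g x + s * c) \<longlongrightarrow> g x) (at_right 0)"
      by (auto intro!: tendsto_eq_intros)
    have "isCont g (x + t *\<^sub>R e)"
      using cont by (simp add: continuous_on_eq_continuous_at)
    moreover have "((\<lambda>s. (1 - s) *\<^sub>R x + t *\<^sub>R e) \<longlongrightarrow> x + t *\<^sub>R e) (at_right 0)"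
      by (auto intro!: tendsto_eq_intros)
    ultimately show "((\<lambda>s. g ((1 - s) *\<^sub>R x + t *\<^sub>R e)) \<longlongrightarrow> g (x + t *\<^sub>R e)) (at_right 0)"
      by (rule isCont_tendsto_compose)
    show "\<forall>\<^sub>F s in at_right 0. g ((1 - s) *\<^sub>R x + t *\<^sub>R e) \<le> (1 - s) * g x + s * c"
      using eventually_at_right_real[of 0 1, simplified]
    proof eventually_elim
      case (elim s)
      then show ?case
        using convex_onD[OF cvx, of s x "(t / s) *\<^sub>R e"] line[of "t / s"] by simp
    qed
  qed
  from le[of x t] le[of "x + t *\<^sub>R e" "- t"] show ?thesis by simp
qed

text \<open>A half-line is infinite, whereas a nonzero univariate polynomial has finitely many
  roots.\<close>

lemma real_polynomial_function_zero_on_half_line: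
  fixes \<phi> :: "real \<Rightarrow> real"
  assumes "real_polynomial_function \<phi>" and zero: "\<And>t. 0 \<le> t \<Longrightarrow> \<phi> t = 0"
  shows "\<phi> t = 0"
proof -
  obtain a n where \<phi>: "\<phi> = (\<lambda>x. \<Sum>i\<le>n. a i * x ^ i)"
    using assms(1) by (auto simp: real_polynomial_function_iff_sum)
  have "infinite {x. (\<Sum>i\<le>n. a i * x ^ i) = 0}"
    using zero infinite_Ici[of "0::real"] unfolding \<phi>
    by (metis (mono_tags, lifting) atLeast_iff mem_Collect_eq rev_finite_subset subsetI)
  then have "\<forall>i\<le>n. a i = 0"
    using polyfun_finite_roots[of a n] by blast
  then show ?thesis
    by (simp add: \<phi>)
qed

section \<open>Polynomials in matrix entries and the Frobenius norm\<close>

lemma real_polynomial_function_entry: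
  "real_polynomial_function (\<lambda>X :: real ^ 'n ^ 'm. X $ i $ j)"
  by (intro real_polynomial_function.intros(1) bounded_linear_compose[OF bounded_linear_vec_nth]
      bounded_linear_vec_nth)

lemma real_polynomial_function_fst:
  "real_polynomial_function h \<Longrightarrow> real_polynomial_function (\<lambda>x. h (fst x))"
  using real_polynomial_function_compose[OF polynomial_function_bounded_linear[OF bounded_linear_fst]]
  by (simp add: o_def)

lemma real_polynomial_function_snd:
  "real_polynomial_function h \<Longrightarrow> real_polynomial_function (\<lambda>x. h (snd x))"
  using real_polynomial_function_compose[OF polynomial_function_bounded_linear[OF bounded_linear_snd]]
  by (simp add: o_def)

lemmas real_polynomial_function_intros = real_polynomial_function.intros(2-4)
  real_polynomial_function_diff real_polynomial_function_power
  real_polynomial_function_entry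

lemma frobenius_norm_2_squared:
  fixes X :: "real ^ 2 ^ 2"
  shows "(frobenius_norm X)\<^sup>2
    = (X $ 1 $ 1)\<^sup>2 + (X $ 2 $ 1)\<^sup>2 + (X $ 1 $ 2)\<^sup>2 + (X $ 2 $ 2)\<^sup>2"
  by (simp add: frobenius_norm_def trace_def transpose_def matrix_matrix_mult_def sum_2
      power2_eq_square[symmetric])

section \<open>Nonexistence of a convex lift\<close>

lemma not_lifted_sos_polyconvex:
  fixes f :: "real ^ 2 ^ 2 \<Rightarrow> real"
  assumes f: "\<And>X. f X = (frobenius_norm X)\<^sup>2 * ((frobenius_norm X)\<^sup>2 - 2 * det X)"
  shows "\<not> lifted_sos_polyconvex f"
proof
  assume "lifted_sos_polyconvex f"
  then obtain g where g: "sos_convex g" and fg: "f = g \<circ> minors"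
    by (auto simp: lifted_sos_polyconvex_def)
  have poly: "real_polynomial_function g"
    using g by (simp add: sos_convex_def)
  have cvx: "convex_on UNIV g"
    using g by (rule sos_convex_imp_convex_on)
  \<comment> \<open>Diagonal matrices with conformal part s and anticonformal part t, the
    determinant slot d being left free. The point lies in the image of \<open>minors\<close> exactly
    when d = s^2 - t^2.\<close>
  define L :: "real \<Rightarrow> real \<Rightarrow> real \<Rightarrow> real ^ 5"
    where "L s t d = vector [s + t, 0, 0, s - t, d]" for s t d
  have gL: "g (L s t (s\<^sup>2 - t\<^sup>2)) = 8 * t\<^sup>2 * (s\<^sup>2 + t\<^sup>2)" for s t
  proof -
    let ?X = "vector [vector [s + t, 0], vector [0, s - t]] :: real ^ 2 ^ 2"
    have "minors ?X = L s t (s\<^sup>2 - t\<^sup>2)"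
      by (simp add: minors_def L_def det_2 power2_eq_square algebra_simps)
    moreover have "f ?X = 8 * t\<^sup>2 * (s\<^sup>2 + t\<^sup>2)"
      unfolding f frobenius_norm_2_squared by (simp add: det_2) algebra
    ultimately show ?thesis
      by (simp add: fg)
  qed
  have conv: "g (L ((1-r) * s + r * s') ((1-r) * t + r * t') ((1-r) * d + r * d'))
      \<le> (1 - r) * g (L s t d) + r * g (L s' t' d')" if "0 \<le> r" "r \<le> 1" for r s t d s' t' d'
  proof -
    have "L ((1-r) * s + r * s') ((1-r) * t + r * t') ((1-r) * d + r * d')
        = (1 - r) *\<^sub>R L s t d + r *\<^sub>R L s' t' d'"
      by (simp add: vec_eq_iff forall_5 L_def algebra_simps)
    then show ?thesis
      using convex_onD[OF cvx that] by simp
  qed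
  define e :: "real ^ 5" where "e = axis 5 1"
  have Le: "L s t d + r *\<^sub>R e = L s t (d + r)" for s t d r
    by (simp add: vec_eq_iff forall_5 L_def e_def axis_def)
  have "L 0 0 0 = 0"
    by (simp add: vec_eq_iff forall_5 L_def)
  then have L0: "L 0 0 d = d *\<^sub>R e" for d
    using Le[of 0 0 0 d] by simp
  \<comment> \<open>\<open>s = 0\<close> and \<open>t = 0\<close> are the anticonformal and the conformal diagonal matrices.\<close>
  have upper: "g (L 0 0 d) \<le> 0" if "0 \<le> d" for d
    using conv[of "1/2" "sqrt d" "- sqrt d" 0 0 d d] gL[of "sqrt d" 0] gL[of "- sqrt d" 0] that
    by simp
  have left: "g (L 0 0 (- (t\<^sup>2))) \<le> 8 * t\<^sup>2 * t\<^sup>2" for t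
    using conv[of "1/2" 0 0 t "-t" "- (t\<^sup>2)" "- (t\<^sup>2)"] gL[of 0 t] gL[of 0 "-t"]
    by (simp add: power2_eq_square)
  have lower: "0 \<le> g (L 0 0 d)" if "0 \<le> d" for d
  proof (cases "d = 0")
    case True
    then show ?thesis using gL[of 0 0] by simp
  next
    case False
    with that have "0 < d" by simp
    \<comment> \<open>The origin, where \<open>g\<close> is 0, divides the segment from -u to d with
      weight u / (u + d) at d. The value at -u is at most 8 u^2, of second order, so dividing by u
      leaves a bound that tends to 0 with u.\<close>
    have *: "- (8 * d * u) \<le> g (L 0 0 d)" if "0 < u" for u
    proof -
      have r: "1 - u / (u + d) = d / (u + d)"
        using \<open>0 < d\<close> \<open>0 < u\<close> by (simp add: field_simps)
      have "0 \<le> d / (u + d) * g (L 0 0 (- u)) + u / (u + d) * g (L 0 0 d)"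
        using conv[of "u / (u + d)" 0 0 0 0 "- u" d] gL[of 0 0] \<open>0 < d\<close> \<open>0 < u\<close>
        unfolding r by (simp add: mult.commute)
      also have "\<dots> = (d * g (L 0 0 (- u)) + u * g (L 0 0 d)) / (u + d)"
        by (simp add: add_divide_distrib)
      finally have "0 \<le> d * g (L 0 0 (- u)) + u * g (L 0 0 d)"
        using \<open>0 < d\<close> \<open>0 < u\<close> by (simp add: zero_le_divide_iff)
      also have "\<dots> \<le> d * (8 * u * u) + u * g (L 0 0 d)"
        using left[of "sqrt u"] \<open>0 < d\<close> \<open>0 < u\<close> by simp
      also have "\<dots> = u * (8 * d * u + g (L 0 0 d))"
        by (simp add: algebra_simps)
      finally show ?thesis
        using \<open>0 < u\<close> by (simp add: zero_le_mult_iff)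
    qed
    show ?thesis
    proof (rule ccontr)
      assume "\<not> 0 \<le> g (L 0 0 d)"
      then show False
        \<comment> \<open>This u is positive and turns the lower bound into half of the supposedly
          negative value, which exceeds that value.\<close>
        using *[of "- g (L 0 0 d) / (16 * d)"] \<open>0 < d\<close> by (simp add: field_simps)
    qed
  qed
  have zero: "g (d *\<^sub>R e) = 0" for d
  proof (rule real_polynomial_function_zero_on_half_line[where \<phi> = "\<lambda>d. g (d *\<^sub>R e)"])
    have "polynomial_function (\<lambda>d::real. d *\<^sub>R e)"
      by (intro polynomial_function_bounded_linear bounded_linear_intros)
    from real_polynomial_function_compose[OF this poly]
    show "real_polynomial_function (\<lambda>d. g (d *\<^sub>R e))"
      by (simp add: o_def)
    show "g (d *\<^sub>R e) = 0" if "0 \<le> d" for d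
      using upper[OF that] lower[OF that] by (simp add: L0)
  qed
  have "continuous_on UNIV g"
    using poly by (simp add: continuous_on_polymonial_function flip: real_polynomial_function_eq)
  then have "g (x + t *\<^sub>R e) = g x" for x t
    using zero by (rule convex_on_constant_along_line[OF cvx])
  then have indep: "g (L s t d) = g (L s t 0)" for s t d
    by (metis Le add_0)
  \<comment> \<open>Midpoint convexity fails for 8 t^2 (s^2 + t^2) between (4, 0) and (0, 1): the
    midpoint value is 17/2, the mean of the end values 4.\<close>
  have "g (L 2 (1/2) 0) \<le> g (L 4 0 0) / 2 + g (L 0 1 0) / 2"
    using conv[of "1/2" 4 0 0 1 0 0] by simp
  moreover have "g (L s t 0) = 8 * t\<^sup>2 * (s\<^sup>2 + t\<^sup>2)" for s t
    using gL indep by metis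
  ultimately show False
    by (simp add: power2_eq_square)
qed

section \<open>The sum-of-squares certificate\<close>

lemma sos_polyconvex_example:
  fixes f :: "real ^ 2 ^ 2 \<Rightarrow> real"
  assumes f: "\<And>X. f X = (frobenius_norm X)\<^sup>2 * ((frobenius_norm X)\<^sup>2 - 2 * det X)"
  shows "sos_polyconvex f"
proof -
  let ?N = "\<lambda>Y :: real ^ 2 ^ 2.
    (Y $ 1 $ 1)\<^sup>2 + (Y $ 2 $ 1)\<^sup>2 + (Y $ 1 $ 2)\<^sup>2 + (Y $ 2 $ 2)\<^sup>2"
  let ?d = "\<lambda>Y :: real ^ 2 ^ 2. Y $ 1 $ 1 * Y $ 2 $ 2 - Y $ 1 $ 2 * Y $ 2 $ 1"
  \<comment> \<open>The last component is the multiplier of the determinant; the others are then forced by the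
    difference having a critical point at \<open>X = Y\<close>.\<close>
  define q :: "real ^ 2 ^ 2 \<Rightarrow> real ^ 5" where "q Y = vector
    [4 * (?N Y - ?d Y) * Y $ 1 $ 1 + 4 * ?d Y * Y $ 2 $ 2,
     4 * (?N Y - ?d Y) * Y $ 2 $ 1 - 4 * ?d Y * Y $ 1 $ 2,
     4 * (?N Y - ?d Y) * Y $ 1 $ 2 - 4 * ?d Y * Y $ 2 $ 1,
     4 * (?N Y - ?d Y) * Y $ 2 $ 2 + 4 * ?d Y * Y $ 1 $ 1,
     - 2 * (?N Y + 2 * ?d Y)]" for Y
  \<comment> \<open>Twice the conformal and anticonformal coordinates. With these, \<open>?N\<close>
    is (|a|^2 + |b|^2) / 2 and \<open>?d\<close> is (|a|^2 - |b|^2) / 4, so the last entry of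
    \<open>q\<close> equals -2 |a|^2.\<close>
  define a\<^sub>1 a\<^sub>2 b\<^sub>1 b\<^sub>2 :: "real ^ 2 ^ 2 \<Rightarrow> real" where
    "a\<^sub>1 Y = Y $ 1 $ 1 + Y $ 2 $ 2" and "a\<^sub>2 Y = Y $ 2 $ 1 - Y $ 1 $ 2" and
    "b\<^sub>1 Y = Y $ 1 $ 1 - Y $ 2 $ 2" and "b\<^sub>2 Y = Y $ 2 $ 1 + Y $ 1 $ 2" for Y
  note ab_defs = a\<^sub>1_def a\<^sub>2_def b\<^sub>1_def b\<^sub>2_def
  have ab_poly: "real_polynomial_function a\<^sub>1" "real_polynomial_function a\<^sub>2"
    "real_polynomial_function b\<^sub>1" "real_polynomial_function b\<^sub>2"
    unfolding ab_defs by (intro real_polynomial_function_intros)+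
  note fst_poly = ab_poly[THEN real_polynomial_function_fst]
  note snd_poly = ab_poly[THEN real_polynomial_function_snd]
  have "real_polynomial_function (\<lambda>Y. q Y $ i)" for i
    using exhaust_5[of i]
    by (elim disjE) (simp_all only: q_def vector_5, (intro real_polynomial_function_intros)+)
  then have q_poly: "polynomial_function q"
    by (rule polynomial_function_vec)
  have f_eq: "f = (\<lambda>X. ?N X * (?N X - 2 * ?d X))"
    by (simp add: fun_eq_iff f frobenius_norm_2_squared det_2)
  have f_poly: "real_polynomial_function f"
    unfolding f_eq by (intro real_polynomial_function_intros)
  \<comment> \<open>Cleared of the factors 1/2 so that \<open>algebra\<close> can decide it.\<close>
  have twice: "2 * (f X - f Y - q Y \<bullet> (minors X - minors Y))
      = (b\<^sub>1 X * (a\<^sub>1 X - a\<^sub>1 Y))\<^sup>2 + (b\<^sub>1 X * (a\<^sub>2 X - a\<^sub>2 Y))\<^sup>2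
      + (b\<^sub>2 X * (a\<^sub>1 X - a\<^sub>1 Y))\<^sup>2 + (b\<^sub>2 X * (a\<^sub>2 X - a\<^sub>2 Y))\<^sup>2
      + ((b\<^sub>1 X)\<^sup>2 + (b\<^sub>2 X)\<^sup>2 - (b\<^sub>1 Y)\<^sup>2 - (b\<^sub>2 Y)\<^sup>2
          + a\<^sub>1 Y * (a\<^sub>1 X - a\<^sub>1 Y) + a\<^sub>2 Y * (a\<^sub>2 X - a\<^sub>2 Y))\<^sup>2
      + (a\<^sub>1 Y * a\<^sub>2 X - a\<^sub>2 Y * a\<^sub>1 X)\<^sup>2
      + 2 * (b\<^sub>1 Y * (b\<^sub>1 X - b\<^sub>1 Y))\<^sup>2 + 2 * (b\<^sub>1 Y * (b\<^sub>2 X - b\<^sub>2 Y))\<^sup>2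
      + 2 * (b\<^sub>2 Y * (b\<^sub>1 X - b\<^sub>1 Y))\<^sup>2 + 2 * (b\<^sub>2 Y * (b\<^sub>2 X - b\<^sub>2 Y))\<^sup>2" for X Y
    unfolding f_eq q_def minors_def det_2 inner_vec_def sum_5 ab_defs vector_minus_component
      vector_5 inner_real_def
    by algebra
  \<comment> \<open>Products of two squared lengths are expanded into four squares each. Every
    summand carries an explicit weight, even 1, to fit \<open>sos_scaled_square\<close>.\<close>
  have certificate: "f X - f Y - q Y \<bullet> (minors X - minors Y)
      = 1/2 * (b\<^sub>1 X * (a\<^sub>1 X - a\<^sub>1 Y))\<^sup>2 + 1/2 * (b\<^sub>1 X * (a\<^sub>2 X - a\<^sub>2 Y))\<^sup>2
      + 1/2 * (b\<^sub>2 X * (a\<^sub>1 X - a\<^sub>1 Y))\<^sup>2 + 1/2 * (b\<^sub>2 X * (a\<^sub>2 X - a\<^sub>2 Y))\<^sup>2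
      + 1/2 * ((b\<^sub>1 X)\<^sup>2 + (b\<^sub>2 X)\<^sup>2 - (b\<^sub>1 Y)\<^sup>2 - (b\<^sub>2 Y)\<^sup>2
          + a\<^sub>1 Y * (a\<^sub>1 X - a\<^sub>1 Y) + a\<^sub>2 Y * (a\<^sub>2 X - a\<^sub>2 Y))\<^sup>2
      + 1/2 * (a\<^sub>1 Y * a\<^sub>2 X - a\<^sub>2 Y * a\<^sub>1 X)\<^sup>2
      + 1 * (b\<^sub>1 Y * (b\<^sub>1 X - b\<^sub>1 Y))\<^sup>2 + 1 * (b\<^sub>1 Y * (b\<^sub>2 X - b\<^sub>2 Y))\<^sup>2
      + 1 * (b\<^sub>2 Y * (b\<^sub>1 X - b\<^sub>1 Y))\<^sup>2 + 1 * (b\<^sub>2 Y * (b\<^sub>2 X - b\<^sub>2 Y))\<^sup>2" for X Y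
    using twice[of X Y] by simp
  have "sos (\<lambda>(X, Y). f X - f Y - q Y \<bullet> (minors X - minors Y))"
    unfolding certificate case_prod_unfold
    by (intro sos_add sos_scaled_square real_polynomial_function_intros fst_poly snd_poly) simp_all
  then show ?thesis
    unfolding sos_polyconvex_def using f_poly q_poly by blast
qed

theorem theorem2p4:
  fixes f :: "real ^ 2 ^ 2 \<Rightarrow> real"
  assumes "\<And>X. f X = (frobenius_norm X)\<^sup>2 * ((frobenius_norm X)\<^sup>2 - 2 * det X)"
  shows "sos_polyconvex f \<and> \<not> lifted_sos_polyconvex f"
  using sos_polyconvex_example[OF assms] not_lifted_sos_polyconvex[OF assms] by blast

end
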